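(* Let $X=[0,1]^d$, $Y=[-A,A]$, and let $\varrho$ be a Borel probability measure on $X\times Y$ with marginal $\varrho_X$ on $X$ and regression function $f_\varrho$. For any family $\mathbf{M}=\{M_v\}_{v\in T}$ of measurable functions on $X$ with $0\le M_v(x)\le 1$ for all $v\in T$, $x\in X$, and $\sum_{v\in T}M_v(x)=1$ for all $x\in X$, $$E\,\|Q_{\mathbf{M}}f_\varrho-f_{\mathbf{z}}\|^2=O\!\left(\frac{N}{m}\right),$$ where $N=|T|$, $m$ is the sample size, the expectation is over the sample $\mathbf{z}$ of $m$ independent observations distributed according to $\varrho$, and $\|\cdot\|$ is the norm of $L^2(X,\varrho_X)$.
   Context: Write $d\varrho(x,y)=d\varrho(y|x)\,d\varrho_X(x)$, where $\varrho_X(S)=\varrho(S\times Y)$ is the marginal probability measure on $X$. The regression function is $f_\varrho(x)=\int_Y y\,d\varrho(y|x)$. The norm $\|\cdot\|$ is that of $L^2(X,\varrho_X)$. The data $\mathbf{z}=(z_1,\dots,z_m)$ consist of $m$ independent random observations $z_j=(x_j,y_j)\in X\times Y$, identically distributed according to $\varrho$. For a family $\mathbf{M}=\{M_v\}_{v\in T}$ as in the claim, define the operator $$Q_{\mathbf{M}}f(x)=\sum_{v\in T}c_v(f)M_v(x),\quad c_v(f)=\frac{\alpha_v(f)}{\varrho_v},\quad \alpha_v(f)=\int_X fM_v\,d\varrho_X,\quad \varrho_v=\int_X M_v\,d\varrho_X,$$ with the convention $c_v(f)=0$ if $\varrho_v=0$. The estimator (depending on $\mathbf{M}$ and $\mathbf{z}$)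 is $$f_{\mathbf{z}}(x)=\sum_{v\in T}c_v(\mathbf{z})M_v(x),\quad c_v(\mathbf{z})=\frac{\alpha_v(\mathbf{z})}{\varrho_v(\mathbf{z})},\quad \alpha_v(\mathbf{z})=\frac1m\sum_{j=1}^m y_jM_v(x_j),\quad \varrho_v(\mathbf{z})=\frac1m\sum_{j=1}^m M_v(x_j),$$ with the convention $c_v(\mathbf{z})=0$ if $\varrho_v(\mathbf{z})=0$. *)

theory Defs
  imports "HOL-Probability.Probability"
begin

definition unit_cube :: "(real ^ 'd) set" where
  "unit_cube = cbox 0 1"

definition borel_prob_on_XY :: "real \<Rightarrow> ((real ^ 'd) \<times> real) measure \<Rightarrow> bool" where
  "borel_prob_on_XY A \<rho> \<longleftrightarrow>
     prob_space \<rho> \<and> sets \<rho> = sets (restrict_space borel (unit_cube \<times> {- A..A}))"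

definition marginal_X :: "((real ^ 'd) \<times> real) measure \<Rightarrow> (real ^ 'd) measure" where
  "marginal_X \<rho> = distr \<rho> (restrict_space borel unit_cube) fst"

text \<open>The probability kernel \<open>\<kappa>\<close> is a version of the conditional distribution
  \<open>x \<mapsto> \<rho>(\<cdot>|x)\<close>, i.e. \<open>d\<rho>(x,y) = d\<kappa>\<^sub>x(y) d\<rho>\<^sub>X(x)\<close>.  Such a kernel exists for every
  Borel probability measure on the cube times an interval and is unique up to
  \<open>\<rho>\<^sub>X\<close>-null sets.\<close>

definition conditional_distribution ::
    "real \<Rightarrow> ((real ^ 'd) \<times> real) measure \<Rightarrow> (real ^ 'd \<Rightarrow> real measure) \<Rightarrow> bool" where
  "conditional_distribution A \<rho> \<kappa> \<longleftrightarrow>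
     \<kappa> \<in> measurable (restrict_space borel unit_cube) (prob_algebra (restrict_space borel {- A..A})) \<and>
     (\<forall>E \<in> sets \<rho>. emeasure \<rho> E = (\<integral>\<^sup>+ x. emeasure (\<kappa> x) {y. (x, y) \<in> E} \<partial>marginal_X \<rho>))"

definition regression_function :: "(real ^ 'd \<Rightarrow> real measure) \<Rightarrow> real ^ 'd \<Rightarrow> real" where
  "regression_function \<kappa> x = (\<integral> y. y \<partial>\<kappa> x)"

text \<open>Indexing by a finite set of naturals rather than by a type variable loses no generality and
  allows constants to be quantified uniformly over all index sets.\<close>

definition partition_family :: "nat set \<Rightarrow> (nat \<Rightarrow> real ^ 'd \<Rightarrow> real) \<Rightarrow> bool" where
  "partition_family T M \<longleftrightarrow>
     finite T \<and>
     (\<forall>v\<in>T. M v \<in> borel_measurable (restrict_space borel unit_cube)) \<and>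
     (\<forall>v\<in>T. \<forall>x\<in>unit_cube. 0 \<le> M v x \<and> M v x \<le> 1) \<and>
     (\<forall>x\<in>unit_cube. (\<Sum>v\<in>T. M v x) = 1)"

definition coeff :: "'a measure \<Rightarrow> ('a \<Rightarrow> real) \<Rightarrow> ('a \<Rightarrow> real) \<Rightarrow> real" where
  "coeff \<mu> Mv f =
     (if (\<integral> x. Mv x \<partial>\<mu>) = 0 then 0 else (\<integral> x. f x * Mv x \<partial>\<mu>) / (\<integral> x. Mv x \<partial>\<mu>))"

definition Q_operator ::
    "'a measure \<Rightarrow> nat set \<Rightarrow> (nat \<Rightarrow> 'a \<Rightarrow> real) \<Rightarrow> ('a \<Rightarrow> real) \<Rightarrow> 'a \<Rightarrow> real" where
  "Q_operator \<mu> T M f x = (\<Sum>v\<in>T. coeff \<mu> (M v) f * M v x)"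

definition alpha_emp :: "nat \<Rightarrow> (nat \<Rightarrow> 'a \<times> real) \<Rightarrow> ('a \<Rightarrow> real) \<Rightarrow> real" where
  "alpha_emp m z Mv = (\<Sum>j<m. snd (z j) * Mv (fst (z j))) / real m"

definition rho_emp :: "nat \<Rightarrow> (nat \<Rightarrow> 'a \<times> real) \<Rightarrow> ('a \<Rightarrow> real) \<Rightarrow> real" where
  "rho_emp m z Mv = (\<Sum>j<m. Mv (fst (z j))) / real m"

definition coeff_emp :: "nat \<Rightarrow> (nat \<Rightarrow> 'a \<times> real) \<Rightarrow> ('a \<Rightarrow> real) \<Rightarrow> real" where
  "coeff_emp m z Mv = (if rho_emp m z Mv = 0 then 0 else alpha_emp m z Mv / rho_emp m z Mv)"

definition estimator ::
    "nat set \<Rightarrow> (nat \<Rightarrow> 'a \<Rightarrow> real) \<Rightarrow> nat \<Rightarrow> (nat \<Rightarrow> 'a \<times> real) \<Rightarrow> 'a \<Rightarrow> real" where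
  "estimator T M m z x = (\<Sum>v\<in>T. coeff_emp m z (M v) * M v x)"

text \<open>Squared \<open>L\<^sup>2\<close> norms and expectations of nonnegative quantities are taken in
  \<open>ennreal\<close>, so that they are genuine (possibly infinite) values and never the default value
  \<open>0\<close> of the Bochner integral.\<close>

definition L2_norm_sq :: "'a measure \<Rightarrow> ('a \<Rightarrow> real) \<Rightarrow> ennreal" where
  "L2_norm_sq \<mu> g = (\<integral>\<^sup>+ x. ennreal ((g x)\<^sup>2) \<partial>\<mu>)"

text \<open>The law of a sample of \<open>m\<close> independent observations is the \<open>m\<close>-fold product of \<open>\<rho>\<close>.\<close>

definition expected_sample ::
    "'b measure \<Rightarrow> nat \<Rightarrow> ((nat \<Rightarrow> 'b) \<Rightarrow> ennreal) \<Rightarrow> ennreal" where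
  "expected_sample \<rho> m F = (\<integral>\<^sup>+ z. F z \<partial>PiM {..<m} (\<lambda>_. \<rho>))"

end

theory Submission imports Defs begin

text \<open>
  Write \<open>r = \<rho>\<^sub>v\<close>, \<open>a = \<alpha>\<^sub>v(f\<^sub>\<rho>)\<close>, \<open>c = a / r\<close>, and \<open>r'\<close>, \<open>a'\<close>, \<open>c'\<close> for their empirical versions.
  Since the \<open>M\<^sub>v(x)\<close> are convex weights, Jensen's inequality bounds the squared norm by the sum over
  \<open>v\<close> of \<open>r (c - c')\<^sup>2\<close>. From \<open>r (c - c') = (a - a') - c' (r - r')\<close> and \<open>\<bar>c'\<bar> \<le> A\<close> one gets
  \<open>r (c - c')\<^sup>2 \<le> 2 ((a - a')\<^sup>2 + A\<^sup>2 (r - r')\<^sup>2) / r\<close>. Both \<open>a'\<close> and \<open>r'\<close> are means of \<open>m\<close> independent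
  copies of a variable with mean \<open>a\<close> resp. \<open>r\<close>, and \<open>0 \<le> M\<^sub>v \<le> 1\<close> bounds the second moments by
  \<open>A\<^sup>2 r\<close> resp. \<open>r\<close>. The factor \<open>r\<close> cancels, so each \<open>v\<close> contributes at most \<open>4 A\<^sup>2 / m\<close>.
\<close>

section \<open>Disintegration of the joint law\<close>

text \<open>The identity map is measurable in both directions between the two spaces. Writing it as
  \<open>(fst x, snd x)\<close> lets measurability be checked one coordinate at a time.\<close>

lemma sets_restrict_space_Times:
  "sets (restrict_space (A \<Otimes>\<^sub>M B) (S \<times> U)) = sets (restrict_space A S \<Otimes>\<^sub>M restrict_space B U)"
    (is "sets ?R = sets ?P")
proof -
  have sp: "space ?R = space ?P"
    by (auto simp: space_restrict_space space_pair_measure)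
  have "(\<lambda>x. (fst x, snd x)) \<in> measurable ?R ?P"
    by (intro measurable_Pair measurable_restrict_space2 measurable_restrict_space1)
       (auto simp: space_restrict_space space_pair_measure)
  then have 1: "E \<in> sets ?R" if "E \<in> sets ?P" for E
    using measurable_sets[OF _ that, of "\<lambda>x. (fst x, snd x)" ?R] sets.sets_into_space[OF that] sp
    by (simp add: Int_absorb2)
  have "(\<lambda>x. (fst x, snd x)) \<in> measurable ?P (A \<Otimes>\<^sub>M B)"
    by (intro measurable_Pair)
      (auto intro!: measurable_compose[OF measurable_fst] measurable_compose[OF measurable_snd] measurable_restrict_space1)
  then have "(\<lambda>x. (fst x, snd x)) \<in> measurable ?P ?R"
    by (intro measurable_restrict_space2) (auto simp: space_restrict_space space_pair_measure)
  then have 2: "E \<in> sets ?P" if "E \<in> sets ?R" for E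
    using measurable_sets[OF _ that, of "\<lambda>x. (fst x, snd x)" ?P] sets.sets_into_space[OF that] sp
    by (simp add: Int_absorb2)
  show ?thesis using 1 2 by blast
qed

text \<open>A kernel formula for the measure of sets is turned into an equation in the Giry monad,
  so that integrals against \<open>\<rho>\<close> can be treated by \<open>integral_bind\<close>.
  The measurability of the lifted kernel is a premise of that rule as well.\<close>

lemma
  assumes sets: "sets \<rho> = sets (\<mu> \<Otimes>\<^sub>M L)"
    and ne: "space \<mu> \<noteq> {}"
    and \<kappa>: "\<kappa> \<in> measurable \<mu> (subprob_algebra L)"
    and em: "\<And>E. E \<in> sets \<rho> \<Longrightarrow> emeasure \<rho> E = (\<integral>\<^sup>+ x. emeasure (\<kappa> x) {y. (x, y) \<in> E} \<partial>\<mu>)"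
  shows disintegration_eq_bind: "\<rho> = \<mu> \<bind> (\<lambda>x. distr (\<kappa> x) (\<mu> \<Otimes>\<^sub>M L) (Pair x))"
    and measurable_distr_Pair: "(\<lambda>x. distr (\<kappa> x) (\<mu> \<Otimes>\<^sub>M L) (Pair x)) \<in> measurable \<mu> (subprob_algebra (\<mu> \<Otimes>\<^sub>M L))"
proof -
  show meas: "(\<lambda>x. distr (\<kappa> x) (\<mu> \<Otimes>\<^sub>M L) (Pair x)) \<in> measurable \<mu> (subprob_algebra (\<mu> \<Otimes>\<^sub>M L))"
    by (rule measurable_distr2[OF _ \<kappa>]) simp
  show "\<rho> = \<mu> \<bind> (\<lambda>x. distr (\<kappa> x) (\<mu> \<Otimes>\<^sub>M L) (Pair x))"
  proof (rule measure_eqI)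
    show "sets \<rho> = sets (\<mu> \<bind> (\<lambda>x. distr (\<kappa> x) (\<mu> \<Otimes>\<^sub>M L) (Pair x)))"
      using sets_bind_measurable[OF meas ne] sets by simp
  next
    fix E assume E: "E \<in> sets \<rho>"
    have "emeasure (\<mu> \<bind> (\<lambda>x. distr (\<kappa> x) (\<mu> \<Otimes>\<^sub>M L) (Pair x))) E
        = (\<integral>\<^sup>+ x. emeasure (distr (\<kappa> x) (\<mu> \<Otimes>\<^sub>M L) (Pair x)) E \<partial>\<mu>)"
      using E sets by (intro emeasure_bind[OF ne meas]) simp
    also have "\<dots> = (\<integral>\<^sup>+ x. emeasure (\<kappa> x) {y. (x, y) \<in> E} \<partial>\<mu>)"
    proof (rule nn_integral_cong)
      fix x assume x: "x \<in> space \<mu>"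
      have sk: "sets (\<kappa> x) = sets L" by (rule sets_kernel[OF \<kappa> x])
      have "Pair x \<in> measurable (\<kappa> x) (\<mu> \<Otimes>\<^sub>M L)"
        using x sk by (simp cong: measurable_cong_sets)
      moreover have "Pair x -` E \<inter> space (\<kappa> x) = {y. (x, y) \<in> E}"
        using sets.sets_into_space[OF E] sets_eq_imp_space_eq[OF sets] sets_eq_imp_space_eq[OF sk]
        by (auto simp: space_pair_measure)
      ultimately show "emeasure (distr (\<kappa> x) (\<mu> \<Otimes>\<^sub>M L) (Pair x)) E = emeasure (\<kappa> x) {y. (x, y) \<in> E}"
        using E sets by (simp add: emeasure_distr)
    qed
    finally show "emeasure \<rho> E = emeasure (\<mu> \<bind> (\<lambda>x. distr (\<kappa> x) (\<mu> \<Otimes>\<^sub>M L) (Pair x))) E"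
      using em[OF E] by simp
  qed
qed

text \<open>Fubini's theorem for a kernel that depends on the first coordinate. The bound
  \<open>B\<close> and the finite total masses supply integrability, as \<open>integral_bind\<close>
  demands.\<close>

lemma integral_disintegration:
  fixes f :: "_ \<Rightarrow> real"
  assumes sets: "sets \<rho> = sets (\<mu> \<Otimes>\<^sub>M L)"
    and \<mu>: "prob_space \<mu>"
    and \<kappa>: "\<kappa> \<in> measurable \<mu> (subprob_algebra L)"
    and em: "\<And>E. E \<in> sets \<rho> \<Longrightarrow> emeasure \<rho> E = (\<integral>\<^sup>+ x. emeasure (\<kappa> x) {y. (x, y) \<in> E} \<partial>\<mu>)"
    and f: "f \<in> borel_measurable \<rho>" and bound: "\<And>x. x \<in> space \<rho> \<Longrightarrow> \<bar>f x\<bar> \<le> B"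
  shows "(\<integral>z. f z \<partial>\<rho>) = (\<integral>x. \<integral>y. f (x, y) \<partial>\<kappa> x \<partial>\<mu>)"
proof -
  interpret \<mu>: prob_space \<mu> by fact
  note bind = disintegration_eq_bind[OF sets \<mu>.not_empty \<kappa> em]
    measurable_distr_Pair[OF sets \<mu>.not_empty \<kappa> em]
  have f': "f \<in> borel_measurable (\<mu> \<Otimes>\<^sub>M L)"
    using f by (simp add: sets cong: measurable_cong_sets)
  have "(\<integral>z. f z \<partial>\<rho>) = (\<integral>z. f z \<partial>(\<mu> \<bind> (\<lambda>x. distr (\<kappa> x) (\<mu> \<Otimes>\<^sub>M L) (Pair x))))"
    using bind(1) by simp
  also have "\<dots> = (\<integral>x. \<integral>z. f z \<partial>distr (\<kappa> x) (\<mu> \<Otimes>\<^sub>M L) (Pair x) \<partial>\<mu>)"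
  proof (rule integral_bind[OF f' _ bind(2) _ AE_I2])
    show "\<bar>f z\<bar> \<le> B" if "z \<in> space (\<mu> \<Otimes>\<^sub>M L)" for z
      using bound that sets_eq_imp_space_eq[OF sets] by simp
    show "finite_measure \<mu>" by unfold_locales
    show "emeasure (distr (\<kappa> x) (\<mu> \<Otimes>\<^sub>M L) (Pair x)) (space (distr (\<kappa> x) (\<mu> \<Otimes>\<^sub>M L) (Pair x))) \<le> ennreal 1"
      if "x \<in> space \<mu>" for x
      using subprob_space.emeasure_space_le_1[OF subprob_space_kernel[OF bind(2) that]] by simp
  qed
  also have "\<dots> = (\<integral>x. \<integral>y. f (x, y) \<partial>\<kappa> x \<partial>\<mu>)"
  proof (rule Bochner_Integration.integral_cong[OF refl])
    fix x assume x: "x \<in> space \<mu>"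
    have sk: "sets (\<kappa> x) = sets L" by (rule sets_kernel[OF \<kappa> x])
    have "Pair x \<in> measurable (\<kappa> x) (\<mu> \<Otimes>\<^sub>M L)"
      using x sk by (simp cong: measurable_cong_sets)
    then show "(\<integral>z. f z \<partial>distr (\<kappa> x) (\<mu> \<Otimes>\<^sub>M L) (Pair x)) = (\<integral>y. f (x, y) \<partial>\<kappa> x)"
      by (rule integral_distr) (rule f')
  qed
  finally show ?thesis .
qed

section \<open>Variance of a sample mean\<close>

text \<open>The integral of a product over distinct coordinates factorises. For
  \<open>j \<noteq> k\<close> one of the factors is the mean of \<open>h\<close>, which
  vanishes.\<close>

lemma (in prob_space) has_bochner_integral_PiM_mult_centered:
  fixes h :: "'a \<Rightarrow> real"
  assumes h: "integrable M h" "integrable M (\<lambda>x. (h x)\<^sup>2)" "expectation h = 0"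
    and I: "finite I" "j \<in> I" "k \<in> I"
  shows "has_bochner_integral (PiM I (\<lambda>_. M)) (\<lambda>z. h (z j) * h (z k))
           (if j = k then expectation (\<lambda>x. (h x)\<^sup>2) else 0)"
proof -
  interpret P: product_sigma_finite "\<lambda>_. M" by unfold_locales
  \<comment> \<open>Padding with the factor 1 at all other coordinates makes the integrand a product
    over the whole of \<open>I\<close>. For \<open>j = k\<close> the two factors meet at one
    coordinate and give the square of \<open>h\<close>.\<close>
  define f where "f i x = (if i = j then h x else 1) * (if i = k then h x else 1)" for i x
  have int: "integrable M (f i)" for i
    using h by (cases "i = j"; cases "i = k") (auto simp: f_def[abs_def] power2_eq_square)
  have eq: "(\<Prod>i\<in>I. f i (z i)) = h (z j) * h (z k)" for z
    using I by (simp add: f_def prod.distrib)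
  have "(\<Prod>i\<in>I. expectation (f i)) = (if j = k then expectation (\<lambda>x. (h x)\<^sup>2) else 0)"
  proof (cases "j = k")
    case True
    then have "expectation (f i) = (if i = j then expectation (\<lambda>x. (h x)\<^sup>2) else 1)" for i
      by (simp add: f_def[abs_def] power2_eq_square prob_space)
    then show ?thesis using I True by simp
  next
    case False
    then have "expectation (f j) = 0" using h by (simp add: f_def[abs_def])
    then show ?thesis using I False by (auto intro: prod_zero)
  qed
  then show ?thesis
    using P.product_integrable_prod[of I f, OF I(1) int] P.product_integral_prod[of I f, OF I(1) int]
    by (simp add: has_bochner_integral_iff eq)
qed

text \<open>After centering, the square of the sum expands into a double sum in which only the
  \<open>m\<close> diagonal terms have nonzero mean; dividing by the square of \<open>m\<close>
  leaves variance over \<open>m\<close>. The form \<open>has_bochner_integral\<close> carries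
  integrability along with the value.\<close>

lemma (in prob_space) has_bochner_integral_sample_mean:
  fixes g :: "'a \<Rightarrow> real"
  assumes g: "integrable M g" "integrable M (\<lambda>x. (g x)\<^sup>2)" and m: "m \<ge> 1"
  shows "has_bochner_integral (PiM {..<m} (\<lambda>_. M))
           (\<lambda>z. (expectation g - (\<Sum>j<m. g (z j)) / real m)\<^sup>2) (variance g / real m)"
proof -
  define h where "h x = g x - expectation g" for x
  have h: "integrable M h" "integrable M (\<lambda>x. (h x)\<^sup>2)" "expectation h = 0"
    using g by (auto simp: h_def[abs_def] power2_diff prob_space)
  have "has_bochner_integral (PiM {..<m} (\<lambda>_. M)) (\<lambda>z. (\<Sum>j<m. \<Sum>k<m. h (z j) * h (z k)) / (real m)\<^sup>2)
      ((\<Sum>j<m. \<Sum>k<m. if j = k then expectation (\<lambda>x. (h x)\<^sup>2) else 0) / (real m)\<^sup>2)"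
    by (intro has_bochner_integral_divide_zero has_bochner_integral_sum has_bochner_integral_PiM_mult_centered h) auto
  moreover have "(\<Sum>j<m. \<Sum>k<m. h (z j) * h (z k)) / (real m)\<^sup>2
      = (expectation g - (\<Sum>j<m. g (z j)) / real m)\<^sup>2" for z
  proof -
    have "(\<Sum>j<m. \<Sum>k<m. h (z j) * h (z k)) / (real m)\<^sup>2 = ((\<Sum>j<m. h (z j)) / real m)\<^sup>2"
      by (simp add: power2_eq_square sum_product)
    also have "(\<Sum>j<m. h (z j)) / real m = - (expectation g - (\<Sum>j<m. g (z j)) / real m)"
      using m by (simp add: h_def sum_subtractf field_simps)
    finally show ?thesis by (simp only: power2_minus)
  qed
  moreover have "(\<Sum>j<m. \<Sum>k<m. if j = k then expectation (\<lambda>x. (h x)\<^sup>2) else 0) / (real m)\<^sup>2 = variance g / real m"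
    using m by (simp add: h_def power2_eq_square)
  ultimately show ?thesis by simp
qed

section \<open>Deterministic error bounds\<close>

text \<open>The empirical coefficient is a weighted average of the observed \<open>snd (z j)\<close>
  with weights \<open>g (fst (z j))\<close>, so it inherits their bound.\<close>

lemma
  assumes "\<And>j. j < m \<Longrightarrow> \<bar>snd (z j)\<bar> \<le> A" "\<And>j. j < m \<Longrightarrow> 0 \<le> g (fst (z j))" "0 \<le> A"
  shows abs_coeff_emp_le: "\<bar>coeff_emp m z g\<bar> \<le> A"
    and coeff_emp_mult_rho_emp: "coeff_emp m z g * rho_emp m z g = alpha_emp m z g"
proof -
  have rho: "0 \<le> rho_emp m z g"
    using assms by (auto simp: rho_emp_def intro!: sum_nonneg divide_nonneg_nonneg)
  have "\<bar>\<Sum>j<m. snd (z j) * g (fst (z j))\<bar> \<le> (\<Sum>j<m. A * g (fst (z j)))"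
    using assms by (intro order_trans[OF sum_abs] sum_mono) (auto simp: abs_mult intro!: mult_right_mono)
  then have alpha: "\<bar>alpha_emp m z g\<bar> \<le> A * rho_emp m z g"
    by (simp add: alpha_emp_def rho_emp_def abs_divide divide_right_mono flip: sum_distrib_left)
  show "\<bar>coeff_emp m z g\<bar> \<le> A"
    using alpha rho assms(3) by (auto simp: coeff_emp_def abs_divide divide_le_eq)
  \<comment> \<open>If \<open>rho_emp\<close> vanishes, then \<open>alpha\<close> forces
    \<open>alpha_emp\<close> to vanish too, so the default value 0 is consistent with this
    identity.\<close>
  show "coeff_emp m z g * rho_emp m z g = alpha_emp m z g"
    using alpha by (auto simp: coeff_emp_def)
qed

text \<open>Using \<open>c' * r' = a'\<close> and the bound on \<open>c'\<close> avoids any division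
  by the empirical \<open>r'\<close>, which may be arbitrarily small. For \<open>r = 0\<close> both
  sides are 0, by the convention for division by zero.\<close>

lemma weighted_ratio_error_le:
  fixes a r a' r' c' A :: real
  assumes "c' * r' = a'" "\<bar>c'\<bar> \<le> A" "0 \<le> r"
  shows "r * ((if r = 0 then 0 else a / r) - c')\<^sup>2 \<le> 2 * ((a - a')\<^sup>2 + A\<^sup>2 * (r - r')\<^sup>2) / r"
proof (cases "r = 0")
  case False
  then have r: "r > 0" using assms by simp
  \<comment> \<open>The extra factor \<open>r\<close> completes the left side to a perfect square;
    it is divided out at the end.\<close>
  have "r * (r * (a / r - c')\<^sup>2) = ((a - a') - c' * (r - r'))\<^sup>2"
    using r assms(1) by (simp add: power2_eq_square field_simps)
  also have "\<dots> \<le> 2 * ((a - a')\<^sup>2 + (c' * (r - r'))\<^sup>2)"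
    using sum_squares_bound[of "a - a'" "- (c' * (r - r'))"] by (simp add: power2_eq_square algebra_simps)
  also have "(c' * (r - r'))\<^sup>2 \<le> A\<^sup>2 * (r - r')\<^sup>2"
    using assms(2) by (simp add: power_mult_distrib mult_right_mono abs_le_square_iff[symmetric])
  finally show ?thesis using r False by (simp add: field_simps)
qed simp

text \<open>Jensen's inequality for the square is applied at each point \<open>x\<close> with
  weights \<open>M v x\<close>. The coefficients do not depend on \<open>x\<close>, so integration
  affects the weights only.\<close>

lemma L2_norm_sq_partition_sum_le:
  assumes T: "finite T" and M: "\<And>v. v \<in> T \<Longrightarrow> integrable \<mu> (M v)"
    and nonneg: "\<And>v x. v \<in> T \<Longrightarrow> x \<in> space \<mu> \<Longrightarrow> 0 \<le> M v x"
    and one: "\<And>x. x \<in> space \<mu> \<Longrightarrow> (\<Sum>v\<in>T. M v x) = 1"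
  shows "L2_norm_sq \<mu> (\<lambda>x. \<Sum>v\<in>T. c v * M v x) \<le> (\<Sum>v\<in>T. ennreal ((\<integral>x. M v x \<partial>\<mu>) * (c v)\<^sup>2))"
proof -
  have "L2_norm_sq \<mu> (\<lambda>x. \<Sum>v\<in>T. c v * M v x) \<le> (\<integral>\<^sup>+ x. (\<Sum>v\<in>T. ennreal (M v x * (c v)\<^sup>2)) \<partial>\<mu>)"
    unfolding L2_norm_sq_def
  proof (rule nn_integral_mono)
    fix x assume x: "x \<in> space \<mu>"
    \<comment> \<open>An empty sum would be 0 instead of 1.\<close>
    have "T \<noteq> {}" using one[OF x] by auto
    then have "(\<Sum>v\<in>T. M v x *\<^sub>R c v)\<^sup>2 \<le> (\<Sum>v\<in>T. M v x * (c v)\<^sup>2)"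
      using T nonneg x one[OF x]
      by (intro convex_on_sum[OF _ _ convex_power2, of T "\<lambda>v. M v x" c]) auto
    then show "ennreal ((\<Sum>v\<in>T. c v * M v x)\<^sup>2) \<le> (\<Sum>v\<in>T. ennreal (M v x * (c v)\<^sup>2))"
      using nonneg x by (subst sum_ennreal) (auto simp: mult.commute intro!: ennreal_leI)
  qed
  also have "\<dots> = (\<Sum>v\<in>T. \<integral>\<^sup>+ x. ennreal (M v x * (c v)\<^sup>2) \<partial>\<mu>)"
    using M by (intro nn_integral_sum) simp
  also have "\<dots> = (\<Sum>v\<in>T. ennreal ((\<integral>x. M v x \<partial>\<mu>) * (c v)\<^sup>2))"
    using M nonneg by (intro sum.cong refl) (subst nn_integral_eq_integral, auto)
  finally show ?thesis .
qed


section \<open>Expected error of the empirical moments\<close>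

lemma (in prob_space) variance_le_expectation_square:
  fixes X :: "'a \<Rightarrow> real"
  assumes "integrable M X" "integrable M (\<lambda>x. (X x)\<^sup>2)"
  shows "variance X \<le> expectation (\<lambda>x. (X x)\<^sup>2)"
  using assms by (simp add: variance_eq)

text \<open>Both variances are at most a constant times \<open>r\<close>, which offsets the division
  by \<open>r\<close> and makes the bound independent of how small \<open>r\<close> is.\<close>

lemma nn_integral_empirical_moments_le:
  fixes \<rho> :: "('a \<times> real) measure"
  assumes \<rho>: "prob_space \<rho>"
    and g: "(\<lambda>z. g (fst z)) \<in> borel_measurable \<rho>" and y: "snd \<in> borel_measurable \<rho>"
    and g_bounds: "\<And>z. z \<in> space \<rho> \<Longrightarrow> 0 \<le> g (fst z) \<and> g (fst z) \<le> 1"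
    and y_bound: "\<And>z. z \<in> space \<rho> \<Longrightarrow> \<bar>snd z\<bar> \<le> A"
    and m: "m \<ge> 1"
  defines "r \<equiv> (\<integral>z. g (fst z) \<partial>\<rho>)" and "a \<equiv> (\<integral>z. snd z * g (fst z) \<partial>\<rho>)"
  shows "(\<integral>\<^sup>+ z. ennreal (2 * ((a - alpha_emp m z g)\<^sup>2 + A\<^sup>2 * (r - rho_emp m z g)\<^sup>2) / r)
            \<partial>PiM {..<m} (\<lambda>_. \<rho>)) \<le> ennreal (4 * A\<^sup>2 / real m)"
proof -
  interpret prob_space \<rho> by fact
  note [measurable] = g y
  let ?G = "\<lambda>z. g (fst z)" and ?H = "\<lambda>z. snd z * g (fst z)"
  have A0: "0 \<le> A" using not_empty y_bound by fastforce
  \<comment> \<open>This keeps the second moments proportional to \<open>r\<close>; the bound 1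
    alone would not cancel the denominator.\<close>
  have g_sq: "(g (fst z))\<^sup>2 \<le> g (fst z)" if "z \<in> space \<rho>" for z
    using g_bounds[OF that] by (simp add: power2_eq_square mult_left_le)
  have yg_sq: "(snd z * g (fst z))\<^sup>2 \<le> A\<^sup>2 * g (fst z)" if "z \<in> space \<rho>" for z
    using y_bound[OF that] g_sq[OF that] A0
    by (auto simp: power_mult_distrib abs_le_square_iff[symmetric] intro!: mult_mono)
  have iG: "integrable \<rho> ?G"
    using g_bounds by (intro integrable_const_bound[where B=1] AE_I2) auto
  have iG2: "integrable \<rho> (\<lambda>z. (?G z)\<^sup>2)"
    using g_bounds by (intro integrable_const_bound[where B=1] AE_I2) (auto simp: abs_square_le_1)
  have iH: "integrable \<rho> ?H"
    using g_bounds y_bound A0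
    by (intro integrable_const_bound[where B="A * 1"] AE_I2) (auto simp: abs_mult intro!: mult_mono simp del: mult_1_right)
  have iH2: "integrable \<rho> (\<lambda>z. (?H z)\<^sup>2)"
    using yg_sq by (intro Bochner_Integration.integrable_bound[OF integrable_mult_right[OF iG, of "A\<^sup>2"]] AE_I2) force+
  have vG: "variance ?G \<le> r"
    using variance_le_expectation_square[OF iG iG2] integral_mono[OF iG2 iG g_sq]
    by (simp add: r_def)
  have vH: "variance ?H \<le> A\<^sup>2 * r"
    using variance_le_expectation_square[OF iH iH2] integral_mono[OF iH2 integrable_mult_right[OF iG] yg_sq]
    by (simp add: r_def)
  have r0: "0 \<le> r"
    unfolding r_def using g_bounds by (intro integral_nonneg_AE AE_I2) auto
  let ?F = "\<lambda>z. 2 * ((a - alpha_emp m z g)\<^sup>2 + A\<^sup>2 * (r - rho_emp m z g)\<^sup>2) / r"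
  \<comment> \<open>Both means come from the same sample, but they enter as separate squares, so
    linearity combines their variances without any cross term.\<close>
  have "has_bochner_integral (PiM {..<m} (\<lambda>_. \<rho>)) ?F
      (2 * (variance ?H / real m + A\<^sup>2 * (variance ?G / real m)) / r)"
    unfolding a_def r_def alpha_emp_def rho_emp_def
    by (intro has_bochner_integral_divide_zero has_bochner_integral_mult_right has_bochner_integral_add
        has_bochner_integral_sample_mean iG iG2 iH iH2 m)
  then have "(\<integral>\<^sup>+ z. ennreal (?F z) \<partial>PiM {..<m} (\<lambda>_. \<rho>))
      = ennreal (2 * (variance ?H / real m + A\<^sup>2 * (variance ?G / real m)) / r)"
    using r0 by (subst nn_integral_eq_integral) (auto simp: has_bochner_integral_iff)
  also have "\<dots> \<le> ennreal (4 * A\<^sup>2 / real m)"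
  proof (intro ennreal_leI)
    have "variance ?H / real m + A\<^sup>2 * (variance ?G / real m) \<le> A\<^sup>2 * r / real m + A\<^sup>2 * (r / real m)"
      using vG vH by (intro add_mono divide_right_mono mult_left_mono) auto
    then have "2 * (variance ?H / real m + A\<^sup>2 * (variance ?G / real m)) / r \<le> 2 * (A\<^sup>2 * r / real m + A\<^sup>2 * (r / real m)) / r"
      using r0 by (intro divide_right_mono mult_left_mono) auto
    \<comment> \<open>The 4 is the factor 2 from splitting the square times two equal contributions.
      For \<open>r = 0\<close> the left side is 0.\<close>
    also have "\<dots> \<le> 4 * A\<^sup>2 / real m"
      using m by (cases "r = 0") (auto simp: field_simps)
    finally show "2 * (variance ?H / real m + A\<^sup>2 * (variance ?G / real m)) / r \<le> 4 * A\<^sup>2 / real m" .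
  qed
  finally show ?thesis .
qed

section \<open>The sample space and the final estimate\<close>

text \<open>Second countability makes the Borel sets of pairs the product of the Borel sets
  (\<open>borel_prod\<close>), which gives the product form that disintegration requires.\<close>

lemma
  fixes \<rho> :: "((real ^ 'd) \<times> real) measure"
  assumes "borel_prob_on_XY A \<rho>"
  shows sets_borel_prob_on_XY: "sets \<rho> = sets (marginal_X \<rho> \<Otimes>\<^sub>M restrict_space borel {- A..A})"
    and space_borel_prob_on_XY: "space \<rho> = unit_cube \<times> {- A..A}"
proof -
  have "sets \<rho> = sets (restrict_space (borel \<Otimes>\<^sub>M borel) (unit_cube \<times> {- A..A}))"
    using assms by (simp add: borel_prob_on_XY_def borel_prod)
  also have "\<dots> = sets (marginal_X \<rho> \<Otimes>\<^sub>M restrict_space borel {- A..A})"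
    unfolding sets_restrict_space_Times by (intro sets_pair_measure_cong) (auto simp: marginal_X_def)
  finally show *: "sets \<rho> = sets (marginal_X \<rho> \<Otimes>\<^sub>M restrict_space borel {- A..A})" .
  then show "space \<rho> = unit_cube \<times> {- A..A}"
    by (simp add: sets_eq_imp_space_eq[OF *] space_pair_measure marginal_X_def space_restrict_space)
qed

theorem theorem1p1:
  fixes A :: real
  shows "\<exists>C>0. \<forall>(\<rho> :: ((real ^ 'd) \<times> real) measure) \<kappa> T M m.
    borel_prob_on_XY A \<rho> \<longrightarrow>
    conditional_distribution A \<rho> \<kappa> \<longrightarrow>
    partition_family T M \<longrightarrow>
    m \<ge> 1 \<longrightarrow>
    expected_sample \<rho> m (\<lambda>z. L2_norm_sq (marginal_X \<rho>)
        (\<lambda>x. Q_operator (marginal_X \<rho>) T M (regression_function \<kappa>) x - estimator T M m z x))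
      \<le> ennreal (C * real (card T) / real m)"
proof (intro exI[of _ "4 * A\<^sup>2 + 1"] conjI allI impI)
  \<comment> \<open>The summand 1 keeps the constant positive when \<open>A = 0\<close>.\<close>
  show "0 < 4 * A\<^sup>2 + 1" by (simp add: add_nonneg_pos)
next
  fix \<rho> :: "((real ^ 'd) \<times> real) measure" and \<kappa> T
    and M :: "nat \<Rightarrow> real ^ 'd \<Rightarrow> real" and m :: nat
  assume \<rho>: "borel_prob_on_XY A \<rho>" and \<kappa>: "conditional_distribution A \<rho> \<kappa>"
    and TM: "partition_family T M" and m: "m \<ge> 1"
  define \<mu> where "\<mu> = marginal_X \<rho>"
  define L where "L = restrict_space borel {- A..A}"
  define r where "r v = (\<integral>x. M v x \<partial>\<mu>)" for v
  define a where "a v = (\<integral>x. regression_function \<kappa> x * M v x \<partial>\<mu>)" for v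
  define e where "e z v = coeff \<mu> (M v) (regression_function \<kappa>) - coeff_emp m z (M v)" for z v
  \<comment> \<open>\<open>F z v\<close> majorises \<open>r v * (e z v)\<^sup>2\<close>. Its
    dependence on \<open>z\<close> is polynomial in the empirical means, so its expectation reduces
    to their variances.\<close>
  define F where "F z v = 2 * ((a v - alpha_emp m z (M v))\<^sup>2 + A\<^sup>2 * (r v - rho_emp m z (M v))\<^sup>2) / r v" for z v
  interpret \<rho>: prob_space \<rho> using \<rho> by (simp add: borel_prob_on_XY_def)
  have T: "finite T"
    and M_meas: "\<And>v. v \<in> T \<Longrightarrow> M v \<in> borel_measurable (restrict_space borel unit_cube)"
    and M_bounds: "\<And>v x. v \<in> T \<Longrightarrow> x \<in> unit_cube \<Longrightarrow> 0 \<le> M v x \<and> M v x \<le> 1"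
    and M_sum: "\<And>x. x \<in> unit_cube \<Longrightarrow> (\<Sum>v\<in>T. M v x) = 1"
    using TM by (auto simp: partition_family_def)
  have sets_\<mu>: "sets \<mu> = sets (restrict_space borel unit_cube)"
    by (simp add: \<mu>_def marginal_X_def)
  have space_\<mu>: "space \<mu> = unit_cube"
    by (simp add: \<mu>_def marginal_X_def space_restrict_space)
  have sets_\<rho>: "sets \<rho> = sets (\<mu> \<Otimes>\<^sub>M L)" and space_\<rho>: "space \<rho> = unit_cube \<times> {- A..A}"
    using sets_borel_prob_on_XY[OF \<rho>] space_borel_prob_on_XY[OF \<rho>] by (simp_all add: \<mu>_def L_def)
  have fst_meas: "fst \<in> measurable \<rho> (restrict_space borel unit_cube)"
    using measurable_fst[of \<mu> L] by (simp add: sets_\<rho> sets_\<mu> cong: measurable_cong_sets)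
  have snd_meas: "snd \<in> borel_measurable \<rho>"
  proof -
    have "snd \<in> borel_measurable (\<mu> \<Otimes>\<^sub>M L)"
      by (rule measurable_compose[OF measurable_snd]) (simp add: L_def measurable_restrict_space1)
    then show ?thesis by (simp add: sets_\<rho> cong: measurable_cong_sets)
  qed
  have A0: "0 \<le> A" using \<rho>.not_empty space_\<rho> by auto
  interpret \<mu>: prob_space \<mu>
    unfolding \<mu>_def marginal_X_def by (rule \<rho>.prob_space_distr[OF fst_meas])
  have \<kappa>_meas: "\<kappa> \<in> measurable \<mu> (subprob_algebra L)"
    using \<kappa> measurable_prob_algebraD[of \<kappa> \<mu> L]
    by (simp add: conditional_distribution_def L_def sets_\<mu> cong: measurable_cong_sets)
  have \<kappa>_em: "emeasure \<rho> E = (\<integral>\<^sup>+ x. emeasure (\<kappa> x) {y. (x, y) \<in> E} \<partial>\<mu>)" if "E \<in> sets \<rho>" for E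
    using \<kappa> that by (simp add: conditional_distribution_def \<mu>_def)
  have Mfst: "(\<lambda>z. M v (fst z)) \<in> borel_measurable \<rho>" if "v \<in> T" for v
    by (rule measurable_compose[OF fst_meas M_meas[OF that]])
  have M_int: "integrable \<mu> (M v)" if "v \<in> T" for v
    using M_bounds[OF that] M_meas[OF that]
    by (intro \<mu>.integrable_const_bound[where B=1] AE_I2) (auto simp: space_\<mu> sets_\<mu> cong: measurable_cong_sets)
  have r_eq: "r v = (\<integral>z. M v (fst z) \<partial>\<rho>)" if "v \<in> T" for v
    unfolding r_def \<mu>_def marginal_X_def by (rule integral_distr[OF fst_meas M_meas[OF that]])
  have r_nonneg: "0 \<le> r v" if "v \<in> T" for v
    unfolding r_def using M_bounds[OF that] by (intro integral_nonneg_AE AE_I2) (auto simp: space_\<mu>)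
  \<comment> \<open>Here \<open>\<kappa>\<close> enters: integrating out \<open>y\<close> first
    turns it into the regression function, so \<open>alpha_emp\<close> has mean
    \<open>a v\<close>.\<close>
  have a_eq: "a v = (\<integral>z. snd z * M v (fst z) \<partial>\<rho>)" if "v \<in> T" for v
  proof -
    note [measurable] = Mfst[OF that] snd_meas
    have "(\<integral>z. snd z * M v (fst z) \<partial>\<rho>) = (\<integral>x. \<integral>y. snd (x, y) * M v (fst (x, y)) \<partial>\<kappa> x \<partial>\<mu>)"
    proof (rule integral_disintegration[OF sets_\<rho> _ \<kappa>_meas \<kappa>_em, where B="A * 1"])
      show "prob_space \<mu>" by unfold_locales
      show "\<bar>snd z * M v (fst z)\<bar> \<le> A * 1" if "z \<in> space \<rho>" for z
        unfolding abs_mult using that M_bounds[OF \<open>v \<in> T\<close>, of "fst z"] by (intro mult_mono) (auto simp: space_\<rho>)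
    qed auto
    then show ?thesis by (simp add: a_def regression_function_def)
  qed
  have L2_le: "L2_norm_sq \<mu> (\<lambda>x. Q_operator \<mu> T M (regression_function \<kappa>) x - estimator T M m z x)
      \<le> (\<Sum>v\<in>T. ennreal (F z v))" if z: "z \<in> space (PiM {..<m} (\<lambda>_. \<rho>))" for z
  proof -
    have zj: "z j \<in> unit_cube \<times> {- A..A}" if "j < m" for j
      using z that by (auto simp: space_PiM PiE_iff space_\<rho>[symmetric])
    have "L2_norm_sq \<mu> (\<lambda>x. Q_operator \<mu> T M (regression_function \<kappa>) x - estimator T M m z x)
        = L2_norm_sq \<mu> (\<lambda>x. \<Sum>v\<in>T. e z v * M v x)"
      by (simp add: Q_operator_def estimator_def e_def left_diff_distrib sum_subtractf)
    also have "\<dots> \<le> (\<Sum>v\<in>T. ennreal (r v * (e z v)\<^sup>2))"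
      unfolding r_def using M_bounds M_sum
      by (intro L2_norm_sq_partition_sum_le T M_int) (auto simp: space_\<mu>)
    also have "\<dots> \<le> (\<Sum>v\<in>T. ennreal (F z v))"
    proof (intro sum_mono ennreal_leI)
      fix v assume v: "v \<in> T"
      have y: "\<bar>snd (z j)\<bar> \<le> A" and x: "0 \<le> M v (fst (z j))" if "j < m" for j
        using zj[OF that] M_bounds[OF v, of "fst (z j)"] by auto
      \<comment> \<open>The convention in \<open>coeff\<close> for a vanishing denominator is
        exactly the case distinction of \<open>weighted_ratio_error_le\<close>.\<close>
      show "r v * (e z v)\<^sup>2 \<le> F z v"
        using weighted_ratio_error_le[OF coeff_emp_mult_rho_emp[of m z A "M v", OF y x A0]
            abs_coeff_emp_le[of m z A "M v", OF y x A0] r_nonneg[OF v], of "a v"]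
        by (auto simp: e_def F_def coeff_def simp flip: r_def a_def)
    qed
    finally show ?thesis .
  qed
  have F_le: "(\<integral>\<^sup>+ z. ennreal (F z v) \<partial>PiM {..<m} (\<lambda>_. \<rho>)) \<le> ennreal (4 * A\<^sup>2 / real m)" if v: "v \<in> T" for v
    unfolding F_def r_eq[OF v] a_eq[OF v]
    using M_bounds[OF v] by (intro nn_integral_empirical_moments_le Mfst v snd_meas m \<rho>.prob_space_axioms) (auto simp: space_\<rho>)
  have F_meas: "(\<lambda>z. ennreal (F z v)) \<in> borel_measurable (PiM {..<m} (\<lambda>_. \<rho>))" if v: "v \<in> T" for v
  proof -
    note [measurable] = Mfst[OF v] snd_meas
    show ?thesis unfolding F_def alpha_emp_def rho_emp_def by measurable
  qed
  have "expected_sample \<rho> m (\<lambda>z. L2_norm_sq \<mu>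
        (\<lambda>x. Q_operator \<mu> T M (regression_function \<kappa>) x - estimator T M m z x))
      \<le> (\<integral>\<^sup>+ z. (\<Sum>v\<in>T. ennreal (F z v)) \<partial>PiM {..<m} (\<lambda>_. \<rho>))"
    \<comment> \<open>The bound holds for every sample in the product space, since each
      \<open>\<bar>snd (z j)\<bar>\<close> is at most \<open>A\<close> there; probability enters
      only afterwards.\<close>
    unfolding expected_sample_def by (intro nn_integral_mono L2_le)
  also have "\<dots> = (\<Sum>v\<in>T. \<integral>\<^sup>+ z. ennreal (F z v) \<partial>PiM {..<m} (\<lambda>_. \<rho>))"
    by (rule nn_integral_sum[OF F_meas])
  also have "\<dots> \<le> (\<Sum>v\<in>T. ennreal (4 * A\<^sup>2 / real m))"
    by (intro sum_mono F_le)
  also have "\<dots> = ennreal (real (card T) * (4 * A\<^sup>2 / real m))"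
    by (simp add: ennreal_of_nat_eq_real_of_nat flip: ennreal_mult')
  also have "\<dots> \<le> ennreal ((4 * A\<^sup>2 + 1) * real (card T) / real m)"
    by (intro ennreal_leI) (simp add: field_simps divide_right_mono)
  finally show "expected_sample \<rho> m (\<lambda>z. L2_norm_sq (marginal_X \<rho>)
        (\<lambda>x. Q_operator (marginal_X \<rho>) T M (regression_function \<kappa>) x - estimator T M m z x))
      \<le> ennreal ((4 * A\<^sup>2 + 1) * real (card T) / real m)"
    by (simp add: \<mu>_def)
qed

end
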